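(* (Logarithmic version of Stirling's formula.) For every integer $n\ge0$ the following identity (with convergent right-hand side) holds in $\mathcal I$: $$\log\big(x(x+1)\cdots(x+n)\big)=B_0\Big((x+n+1)\log(x+n+1)-x\log x-n-1\Big)+B_1\Big(\log(x+n+1)-\log x\Big)+\sum_{k\ge2}\frac{B_k}{k!}(-1)^k(k-2)!\left[\frac1{(x+n+1)^{k-1}}-\frac1{x^{k-1}}\right].$$
   Context: $\mathcal I$ is the discrete iterated logarithmic algebra: the algebra of formal series with complex coefficients in the monomials $x^{a}(\log x)^{\alpha_1}(\log\log x)^{\alpha_2}\cdots$, with $a\in\mathbb Z$ and $(\alpha_1,\alpha_2,\dots)$ a finitely supported vector of integers, where monomials are ordered lexicographically (exponent of $x$ first, then $\alpha_1$, $\alpha_2$, ...) and the support of a series is reverse well-ordered. The derivative $D=d/dx$ acts termwise by the usual rules. For $p\in\mathcal I$ the shift is $p(x+m)=\sum_{k\ge0}\frac{m^k}{k!}D^kp(x)$; thus $\log(x+m)$, $(x+m)^{-k}$ and $(x+m)\log(x+m)$ denote the elements of $\mathcal I$ obtained by shifting $\log x$, $x^{-k}$ and $x\log x$. The expression $\log(x(x+1)\cdots(x+n))$ denotes $\log x+\log(x+1)+\cdots+\log(x+n)$. Infinite sums are taken in $\mathcal I$ coefficientwise. The Bernoulli numbers are $B_k=B_k(0)$, where $B_k(x)=J^{-1}x^k$ are the Bernoulli polynomials and $J=(e^D-1)/D$; equivalently $\sum_{k\ge0}B_kt^k/k!=t/(e^t-1)$. *)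

theory Defs
  imports
    Complex_Main
    "HOL-Library.Poly_Mapping"
    "HOL-Computational_Algebra.Computational_Algebra"
begin

section \<open>Monomials\<close>

text \<open>
  Put \<open>\<ell>\<^sub>0 = x\<close>, \<open>\<ell>\<^sub>1 = log x\<close>, \<open>\<ell>\<^sub>2 = log log x\<close>, and so on.  A finitely supported
  \<open>\<gamma> :: nat \<Rightarrow>\<^sub>0 int\<close> stands for the monomial that is the product of all \<open>\<ell>\<^sub>i\<close> to the power
  \<open>\<gamma> i\<close>; so \<open>\<gamma> 0\<close> is the exponent \<open>a\<close> of \<open>x\<close> and \<open>\<gamma> i\<close> is \<open>\<alpha>\<^sub>i\<close> for \<open>i \<ge> 1\<close>.
  Multiplication of monomials is addition of exponents, and the order that
  \<^theory>\<open>HOL-Library.Poly_Mapping\<close> puts on \<open>nat \<Rightarrow>\<^sub>0 int\<close> is the lexicographic one in which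
  index \<open>0\<close> is the most significant (see lemma \<open>lmono_less_iff\<close>).
\<close>

type_synonym lmono = "nat \<Rightarrow>\<^sub>0 int"

lemma lmono_less_iff:
  fixes \<beta> \<gamma> :: lmono
  shows "\<beta> < \<gamma> \<longleftrightarrow> (\<exists>i. Poly_Mapping.lookup \<beta> i < Poly_Mapping.lookup \<gamma> i \<and> (\<forall>j<i. Poly_Mapping.lookup \<beta> j = Poly_Mapping.lookup \<gamma> j))"
  by transfer (simp add: less_fun_def)

section \<open>Reverse well-ordered sets\<close>

lemma rev_wo_iff_max:
  fixes A :: "'a::linorder set"
  shows "wfp_on A (>) \<longleftrightarrow> (\<forall>B\<subseteq>A. B \<noteq> {} \<longrightarrow> (\<exists>m\<in>B. \<forall>b\<in>B. b \<le> m))"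
proof -
  have "(\<exists>z\<in>B. \<forall>y. z < y \<longrightarrow> y \<notin> B) \<longleftrightarrow> (\<exists>m\<in>B. \<forall>b\<in>B. b \<le> m)" for B :: "'a set"
    by (meson leD leI)
  then show ?thesis unfolding wfp_on_iff_ex_minimal by simp
qed

lemma rev_wo_iff_seq:
  fixes A :: "'a::linorder set"
  shows "wfp_on A (>) \<longleftrightarrow> \<not> (\<exists>s :: nat \<Rightarrow> 'a. strict_mono s \<and> range s \<subseteq> A)"
proof -
  have "wfp_on A (>) \<longleftrightarrow> \<not> (\<exists>s :: nat \<Rightarrow> 'a. \<forall>i. s (Suc i) > s i \<and> s (Suc i) \<in> A \<and> s i \<in> A)"
    unfolding wfp_on_iff_wfp[of A] by (simp only: wfp_def wf_iff_no_infinite_down_chain mem_Collect_eq case_prod_conv)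
  also have "\<dots> \<longleftrightarrow> \<not> (\<exists>s :: nat \<Rightarrow> 'a. strict_mono s \<and> range s \<subseteq> A)"
    unfolding strict_mono_Suc_iff by blast
  finally show ?thesis .
qed

lemma rev_wo_mono: "wfp_on A (>) \<Longrightarrow> B \<subseteq> A \<Longrightarrow> wfp_on B ((>) :: 'a::linorder \<Rightarrow> _)"
  by (rule wfp_on_subset)

lemma rev_wo_Un:
  fixes A B :: "'a::linorder set"
  assumes "wfp_on A (>)" "wfp_on B (>)"
  shows "wfp_on (A \<union> B) (>)"
  unfolding rev_wo_iff_max
proof (intro allI impI)
  fix C assume C: "C \<subseteq> A \<union> B" "C \<noteq> {}"
  have max: "\<exists>m\<in>C \<inter> X. \<forall>b\<in>C \<inter> X. b \<le> m" if "wfp_on X (>)" "C \<inter> X \<noteq> {}" for X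
    using that(1)[unfolded rev_wo_iff_max, rule_format, OF Int_lower2 that(2)] .
  show "\<exists>m\<in>C. \<forall>b\<in>C. b \<le> m"
  proof (cases "C \<inter> A = {} \<or> C \<inter> B = {}")
    case True
    then have "C \<inter> B = C \<or> C \<inter> A = C" using C(1) by blast
    then show ?thesis
    proof
      assume "C \<inter> B = C"
      then show ?thesis using max[OF assms(2)] C(2) by simp
    next
      assume "C \<inter> A = C"
      then show ?thesis using max[OF assms(1)] C(2) by simp
    qed
  next
    case False
    obtain a where a: "a \<in> C" "\<And>c. c \<in> C \<inter> A \<Longrightarrow> c \<le> a"
      using False max[OF assms(1)] by auto
    obtain b where b: "b \<in> C" "\<And>c. c \<in> C \<inter> B \<Longrightarrow> c \<le> b"
      using False max[OF assms(2)] by auto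
    have "max a b \<in> C" using a(1) b(1) by (simp add: max_def)
    moreover have "c \<le> max a b" if "c \<in> C" for c
    proof (cases "c \<in> A")
      case True
      with that have "c \<le> a" using a(2) by blast
      then show ?thesis by (simp add: le_max_iff_disj)
    next
      case False
      with that C(1) have "c \<le> b" using b(2) by blast
      then show ?thesis by (simp add: le_max_iff_disj)
    qed
    ultimately show ?thesis by blast
  qed
qed

lemma rev_wo_UN:
  fixes A :: "'i \<Rightarrow> 'a::linorder set"
  assumes "finite I" "\<And>i. i \<in> I \<Longrightarrow> wfp_on (A i) (>)"
  shows "wfp_on (\<Union>i\<in>I. A i) (>)"
  using assms
proof (induction I rule: finite_induct)
  case empty
  then show ?case by (simp add: rev_wo_iff_seq)
next
  case (insert i I)
  then show ?case by (simp add: rev_wo_Un)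
qed

lemma rev_wo_finite: "finite A \<Longrightarrow> wfp_on A ((>) :: 'a::linorder \<Rightarrow> _)"
  unfolding rev_wo_iff_seq
proof
  assume "finite A" "\<exists>s :: nat \<Rightarrow> 'a. strict_mono s \<and> range s \<subseteq> A"
  then obtain s :: "nat \<Rightarrow> 'a" where s: "strict_mono s" "finite (range s)"
    using finite_subset by blast
  then have "inj s" by (simp add: strict_mono_imp_inj_on)
  with s(2) show False using range_inj_infinite by blast
qed

lemma rev_wo_subseq:
  fixes s :: "nat \<Rightarrow> 'a::linorder"
  assumes "wfp_on A (>)" "range s \<subseteq> A"
  obtains f where "strict_mono (f :: nat \<Rightarrow> nat)" "\<And>m n. m \<le> n \<Longrightarrow> s (f n) \<le> s (f m)"
proof -
  obtain f where f: "strict_mono f" "monoseq (\<lambda>n. s (f n))" using seq_monosub by blast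
  show thesis
  proof (cases "\<forall>m n. m \<le> n \<longrightarrow> s (f n) \<le> s (f m)")
    case True
    then show thesis using f(1) that by blast
  next
    case False
    with f(2) have inc: "\<And>m n. m \<le> n \<Longrightarrow> s (f m) \<le> s (f n)" unfolding monoseq_def by blast
    have ne: "range (\<lambda>n. s (f n)) \<noteq> {}" and sub: "range (\<lambda>n. s (f n)) \<subseteq> A"
      using assms(2) by auto
    obtain k where k: "\<And>n. s (f n) \<le> s (f k)"
      using assms(1)[unfolded rev_wo_iff_max, rule_format, OF sub ne] by auto
    have const: "s (f n) = s (f k)" if "n \<ge> k" for n using inc[OF that] k[of n] by simp
    show thesis
    proof (rule that[of "\<lambda>n. f (n + k)"])
      show "strict_mono (\<lambda>n. f (n + k))" using f(1) by (simp add: strict_mono_def)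
    qed (simp add: const[of "_ + k"])
  qed
qed

lemma rev_wo_plus:
  fixes A B :: "'a::{linorder, ordered_ab_semigroup_add} set"
  assumes "wfp_on A (>)" "wfp_on B (>)"
  shows "wfp_on {a + b | a b. a \<in> A \<and> b \<in> B} (>)"
  unfolding rev_wo_iff_seq
proof
  assume "\<exists>s :: nat \<Rightarrow> 'a. strict_mono s \<and> range s \<subseteq> {a + b | a b. a \<in> A \<and> b \<in> B}"
  then obtain s :: "nat \<Rightarrow> 'a" where s: "strict_mono s" "\<And>n. \<exists>a b. s n = a + b \<and> a \<in> A \<and> b \<in> B"
    by blast
  then obtain a b where ab: "\<And>n. s n = a n + b n" "\<And>n. a n \<in> A" "\<And>n. b n \<in> B" by metis
  obtain f where f: "strict_mono (f :: nat \<Rightarrow> nat)" "\<And>m n. m \<le> n \<Longrightarrow> a (f n) \<le> a (f m)"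
    using rev_wo_subseq[OF assms(1), of a] ab(2) by blast
  obtain g where g: "strict_mono (g :: nat \<Rightarrow> nat)" "\<And>m n. m \<le> n \<Longrightarrow> b (f (g n)) \<le> b (f (g m))"
    using rev_wo_subseq[OF assms(2), of "\<lambda>n. b (f n)"] ab(3) by blast
  have lt: "f (g 0) < f (g 1)" using f(1) g(1) by (simp add: strict_mono_def)
  have "g 0 \<le> g 1" using g(1) by (simp add: strict_mono_less_eq)
  then have "s (f (g 1)) \<le> s (f (g 0))"
    unfolding ab(1) using f(2) g(2)[of 0 1] by (intro add_mono) auto
  with strict_monoD[OF s(1) lt] show False by simp
qed

section \<open>The discrete iterated logarithmic algebra\<close>

text \<open>
  Only the vector space structure is set up; products of series are not needed.
\<close>

typedef ila = "{p :: lmono \<Rightarrow> complex. wfp_on {\<gamma>. p \<gamma> \<noteq> 0} (>)}"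
  morphisms mcoeff Abs_ila
  by (rule exI[of _ "\<lambda>_. 0"]) (simp add: rev_wo_finite)

setup_lifting type_definition_ila

lemma ila_eqI: "(\<And>\<gamma>. mcoeff p \<gamma> = mcoeff q \<gamma>) \<Longrightarrow> p = q"
  by (simp add: mcoeff_inject[symmetric] fun_eq_iff)

definition supp :: "ila \<Rightarrow> lmono set" where
  "supp p = {\<gamma>. mcoeff p \<gamma> \<noteq> 0}"

lemma rev_wo_supp: "wfp_on (supp p) (>)"
  using mcoeff[of p] by (simp add: supp_def)

instantiation ila :: ab_group_add
begin

lift_definition zero_ila :: ila is "\<lambda>_. 0"
  by (simp add: rev_wo_finite)

lift_definition plus_ila :: "ila \<Rightarrow> ila \<Rightarrow> ila" is "\<lambda>p q \<gamma>. p \<gamma> + q \<gamma>"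
  by (drule (1) rev_wo_Un, erule rev_wo_mono) auto

lift_definition uminus_ila :: "ila \<Rightarrow> ila" is "\<lambda>p \<gamma>. - p \<gamma>"
  by simp

lift_definition minus_ila :: "ila \<Rightarrow> ila \<Rightarrow> ila" is "\<lambda>p q \<gamma>. p \<gamma> - q \<gamma>"
  by (drule (1) rev_wo_Un, erule rev_wo_mono) auto

instance
  by standard (transfer; simp add: fun_eq_iff)+

end

lift_definition cscale :: "complex \<Rightarrow> ila \<Rightarrow> ila"  (infixr "*c" 75) is "\<lambda>c p \<gamma>. c * p \<gamma>"
  by (erule rev_wo_mono) auto

definition lmonom :: "lmono \<Rightarrow> ila" where
  "lmonom \<gamma> = Abs_ila (\<lambda>\<beta>. if \<beta> = \<gamma> then 1 else 0)"

lemma mcoeff_lmonom [simp]: "mcoeff (lmonom \<beta>) \<gamma> = (if \<gamma> = \<beta> then 1 else 0)"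
  by (simp add: lmonom_def Abs_ila_inverse rev_wo_finite)

lemma mcoeff_simps [simp]:
  "mcoeff 0 \<gamma> = 0"
  "mcoeff (p + q) \<gamma> = mcoeff p \<gamma> + mcoeff q \<gamma>"
  "mcoeff (- p) \<gamma> = - mcoeff p \<gamma>"
  "mcoeff (p - q) \<gamma> = mcoeff p \<gamma> - mcoeff q \<gamma>"
  "mcoeff (c *c p) \<gamma> = c * mcoeff p \<gamma>"
  by (transfer; simp)+

lemma mcoeff_sum [simp]: "mcoeff (sum f A) \<gamma> = (\<Sum>i\<in>A. mcoeff (f i) \<gamma>)"
  by (induction A rule: infinite_finite_induct) auto

section \<open>Infinite sums\<close>

text \<open>
  A family of formal series is summed coefficient by coefficient, where each coefficient of the
  sum has to be a finite sum (convergence in the discrete topology of the coefficient field).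
\<close>

definition has_fsum :: "('i \<Rightarrow> ila) \<Rightarrow> 'i set \<Rightarrow> ila \<Rightarrow> bool" where
  "has_fsum f A S \<longleftrightarrow>
     (\<forall>\<gamma>. finite {i\<in>A. mcoeff (f i) \<gamma> \<noteq> 0} \<and>
          mcoeff S \<gamma> = (\<Sum>i | i \<in> A \<and> mcoeff (f i) \<gamma> \<noteq> 0. mcoeff (f i) \<gamma>))"

definition fsummable :: "('i \<Rightarrow> ila) \<Rightarrow> 'i set \<Rightarrow> bool" where
  "fsummable f A \<longleftrightarrow> (\<exists>S. has_fsum f A S)"

definition fsum :: "('i \<Rightarrow> ila) \<Rightarrow> 'i set \<Rightarrow> ila" where
  "fsum f A = (THE S. has_fsum f A S)"

lemma has_fsum_unique: "has_fsum f A S \<Longrightarrow> has_fsum f A T \<Longrightarrow> S = T"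
  by (rule ila_eqI) (simp add: has_fsum_def)

lemma fsum_eqI: "has_fsum f A S \<Longrightarrow> fsum f A = S"
  unfolding fsum_def by (rule the_equality) (auto intro: has_fsum_unique)

lemma has_fsum_fsum: "fsummable f A \<Longrightarrow> has_fsum f A (fsum f A)"
  unfolding fsummable_def by (auto simp: fsum_eqI)

lemma has_fsum_imp_sums:
  assumes "has_fsum f (UNIV :: nat set) S"
  shows "(\<lambda>k. mcoeff (f k) \<gamma>) sums mcoeff S \<gamma>"
proof -
  have "finite {k. mcoeff (f k) \<gamma> \<noteq> 0}"
    and "mcoeff S \<gamma> = (\<Sum>k | mcoeff (f k) \<gamma> \<noteq> 0. mcoeff (f k) \<gamma>)"
    using assms unfolding has_fsum_def by simp_all
  then show ?thesis by (simp only:) (rule sums_finite, auto)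
qed

lemma has_fsum_finite:
  assumes "finite A"
  shows "has_fsum f A (\<Sum>i\<in>A. f i)"
  using assms by (auto simp: has_fsum_def intro!: sum.mono_neutral_right)

lemma fsummableI:
  assumes fin: "\<And>\<gamma>. finite {i\<in>A. mcoeff (f i) \<gamma> \<noteq> 0}"
    and wo: "wfp_on (\<Union>i\<in>A. supp (f i)) (>)"
  shows "fsummable f A"
proof -
  define S where "S \<gamma> = (\<Sum>i | i \<in> A \<and> mcoeff (f i) \<gamma> \<noteq> 0. mcoeff (f i) \<gamma>)" for \<gamma>
  have "{\<gamma>. S \<gamma> \<noteq> 0} \<subseteq> (\<Union>i\<in>A. supp (f i))"
  proof
    fix \<gamma> assume "\<gamma> \<in> {\<gamma>. S \<gamma> \<noteq> 0}"
    then have "S \<gamma> \<noteq> 0" by simp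
    then have "{i. i \<in> A \<and> mcoeff (f i) \<gamma> \<noteq> 0} \<noteq> {}"
      by (intro notI) (simp only: S_def sum.empty simp_thms)
    then show "\<gamma> \<in> (\<Union>i\<in>A. supp (f i))" unfolding supp_def by blast
  qed
  then have "wfp_on {\<gamma>. S \<gamma> \<noteq> 0} (>)" by (rule rev_wo_mono[OF wo])
  then obtain T where T: "mcoeff T = S" using Abs_ila_inverse by blast
  have "has_fsum f A T"
    unfolding has_fsum_def T by (simp add: fin S_def)
  then show ?thesis by (auto simp: fsummable_def)
qed

section \<open>The derivative\<close>

text \<open>
  By the chain rule, \<open>D \<ell>\<^sub>i = 1 / (\<ell>\<^sub>0 \<ell>\<^sub>1 \<cdots> \<ell>\<^bsub>i-1\<^esub>)\<close>.  Hence the logarithmic derivative of the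
  \<open>i\<close>-th factor of the monomial \<open>\<gamma>\<close> is \<open>\<gamma> i / (\<ell>\<^sub>0 \<ell>\<^sub>1 \<cdots> \<ell>\<^sub>i)\<close>, and the product rule yields the
  formula for \<open>D_mono\<close>.
\<close>

definition ell_upto :: "nat \<Rightarrow> lmono" where
  "ell_upto i = (\<Sum>j\<le>i. Poly_Mapping.single j 1)"

definition D_mono :: "lmono \<Rightarrow> ila" where
  "D_mono \<gamma> = (\<Sum>i\<in>Poly_Mapping.keys \<gamma>. of_int (Poly_Mapping.lookup \<gamma> i) *c lmonom (\<gamma> - ell_upto i))"

definition D :: "ila \<Rightarrow> ila" where
  "D p = fsum (\<lambda>\<gamma>. mcoeff p \<gamma> *c D_mono \<gamma>) UNIV"

lemma lookup_ell_upto: "Poly_Mapping.lookup (ell_upto i) j = (if j \<le> i then 1 else 0)"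
  by (simp add: ell_upto_def lookup_sum lookup_single when_def)

lemma strict_mono_ell_upto: "strict_mono ell_upto"
  unfolding strict_mono_Suc_iff lmono_less_iff
proof
  fix n
  show "\<exists>i. Poly_Mapping.lookup (ell_upto n) i < Poly_Mapping.lookup (ell_upto (Suc n)) i \<and>
      (\<forall>j<i. Poly_Mapping.lookup (ell_upto n) j = Poly_Mapping.lookup (ell_upto (Suc n)) j)"
    by (rule exI[of _ "Suc n"]) (simp add: lookup_ell_upto)
qed

lemma D_mono_nonzero:
  assumes "mcoeff (D_mono \<gamma>) \<beta> \<noteq> 0"
  obtains i where "\<gamma> = \<beta> + ell_upto i"
proof -
  have "(\<Sum>i\<in>Poly_Mapping.keys \<gamma>. of_int (Poly_Mapping.lookup \<gamma> i) * mcoeff (lmonom (\<gamma> - ell_upto i)) \<beta>) \<noteq> 0"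
    using assms by (simp add: D_mono_def del: mcoeff_lmonom)
  then obtain i where "mcoeff (lmonom (\<gamma> - ell_upto i)) \<beta> \<noteq> 0"
    by (metis (no_types, lifting) mult_zero_right sum.neutral)
  then have "\<beta> = \<gamma> - ell_upto i" by (simp split: if_splits)
  then show thesis using that[of i] by simp
qed

lemma rev_wo_ell: "wfp_on (range (\<lambda>i. - ell_upto i)) (>)"
  unfolding rev_wo_iff_max
proof (intro allI impI)
  fix B assume B: "B \<subseteq> range (\<lambda>i. - ell_upto i)" "B \<noteq> {}"
  define i where "i = (LEAST i. - ell_upto i \<in> B)"
  have ex: "\<exists>i. - ell_upto i \<in> B" using B by blast
  have "- ell_upto i \<in> B" unfolding i_def using ex by (rule LeastI_ex)
  moreover have "b \<le> - ell_upto i" if "b \<in> B" for b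
  proof -
    obtain j where j: "b = - ell_upto j" using B(1) \<open>b \<in> B\<close> by (elim subsetD[THEN rangeE])
    with that have "i \<le> j" unfolding i_def by (intro Least_le) simp
    then have "ell_upto i \<le> ell_upto j" by (simp add: strict_mono_less_eq[OF strict_mono_ell_upto])
    then have "ell_upto i + (- ell_upto i - ell_upto j) \<le> ell_upto j + (- ell_upto i - ell_upto j)"
      by (rule add_right_mono)
    then show ?thesis using j by simp
  qed
  ultimately show "\<exists>m\<in>B. \<forall>b\<in>B. b \<le> m" by blast
qed

lemma D_fsummable: "fsummable (\<lambda>\<gamma>. mcoeff p \<gamma> *c D_mono \<gamma>) UNIV"
proof (rule fsummableI)
  fix \<beta>
  define I where "I = {i. \<beta> + ell_upto i \<in> supp p}"
  have mono: "strict_mono (\<lambda>i. \<beta> + ell_upto i)"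
    using strict_mono_ell_upto by (simp add: strict_mono_def add_strict_left_mono)
  have "finite I"
  proof (rule ccontr)
    assume inf: "infinite I"
    have "strict_mono (\<lambda>n. \<beta> + ell_upto (enumerate I n))"
      using mono strict_mono_enumerate[OF inf] by (simp add: strict_mono_def)
    moreover have "range (\<lambda>n. \<beta> + ell_upto (enumerate I n)) \<subseteq> supp p"
      using enumerate_in_set[OF inf] by (auto simp: I_def)
    ultimately show False using rev_wo_supp[of p] unfolding rev_wo_iff_seq by blast
  qed
  moreover have "{\<gamma> \<in> UNIV. mcoeff (mcoeff p \<gamma> *c D_mono \<gamma>) \<beta> \<noteq> 0} \<subseteq> (\<lambda>i. \<beta> + ell_upto i) ` I"
    by (auto simp: I_def supp_def elim!: D_mono_nonzero)
  ultimately show "finite {\<gamma> \<in> UNIV. mcoeff (mcoeff p \<gamma> *c D_mono \<gamma>) \<beta> \<noteq> 0}"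
    using finite_surj by blast
next
  show "wfp_on (\<Union>\<gamma>\<in>UNIV. supp (mcoeff p \<gamma> *c D_mono \<gamma>)) (>)"
  proof (rule rev_wo_mono[OF rev_wo_plus[OF rev_wo_supp[of p] rev_wo_ell]], rule subsetI)
    fix \<beta> assume "\<beta> \<in> (\<Union>\<gamma>\<in>UNIV. supp (mcoeff p \<gamma> *c D_mono \<gamma>))"
    then obtain \<gamma> where \<gamma>: "mcoeff p \<gamma> \<noteq> 0" "mcoeff (D_mono \<gamma>) \<beta> \<noteq> 0" by (auto simp: supp_def)
    from \<gamma>(2) obtain i where "\<gamma> = \<beta> + ell_upto i" by (rule D_mono_nonzero)
    then have "\<beta> = \<gamma> + - ell_upto i" by simp
    with \<gamma>(1) show "\<beta> \<in> {a + b |a b. a \<in> supp p \<and> b \<in> range (\<lambda>i. - ell_upto i)}"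
      unfolding supp_def by blast
  qed
qed

lemma has_fsum_D: "has_fsum (\<lambda>\<gamma>. mcoeff p \<gamma> *c D_mono \<gamma>) UNIV (D p)"
  unfolding D_def by (rule has_fsum_fsum[OF D_fsummable])

lemma D_mono_eq [simp]: "D (lmonom \<gamma>) = D_mono \<gamma>"
  unfolding D_def
proof (rule fsum_eqI)
  have *: "{i. mcoeff (mcoeff (lmonom \<gamma>) i *c D_mono i) \<beta> \<noteq> 0} =
      (if mcoeff (D_mono \<gamma>) \<beta> = 0 then {} else {\<gamma>})" for \<beta>
    by auto
  show "has_fsum (\<lambda>i. mcoeff (lmonom \<gamma>) i *c D_mono i) UNIV (D_mono \<gamma>)"
    unfolding has_fsum_def using * by simp
qed

lemma supp_D:
  assumes "\<beta> \<in> supp (D p)"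
  obtains i where "\<beta> + ell_upto i \<in> supp p"
proof -
  have "mcoeff (D p) \<beta> \<noteq> 0" using assms by (simp add: supp_def)
  then obtain \<gamma> where \<gamma>: "mcoeff p \<gamma> \<noteq> 0" "mcoeff (D_mono \<gamma>) \<beta> \<noteq> 0"
    using has_fsum_D[of p] unfolding has_fsum_def
    by (metis (no_types, lifting) mcoeff_simps(5) mult_eq_0_iff sum.neutral)
  from \<gamma>(2) obtain i where "\<gamma> = \<beta> + ell_upto i" by (rule D_mono_nonzero)
  with \<gamma>(1) show thesis using that by (simp add: supp_def)
qed

section \<open>Shifts\<close>

definition shift :: "complex \<Rightarrow> ila \<Rightarrow> ila" where
  "shift m p = fsum (\<lambda>k. (m ^ k / fact k) *c (D ^^ k) p) UNIV"

lemma supp_D_pow: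
  assumes "\<beta> \<in> supp ((D ^^ k) p)"
  shows "\<exists>\<gamma>\<in>supp p. Poly_Mapping.lookup \<beta> 0 + int k = Poly_Mapping.lookup \<gamma> 0"
  using assms
proof (induction k arbitrary: \<beta>)
  case 0
  then show ?case by (intro bexI[of _ \<beta>]) simp_all
next
  case (Suc k)
  then have "\<beta> \<in> supp (D ((D ^^ k) p))" by simp
  then obtain i where "\<beta> + ell_upto i \<in> supp ((D ^^ k) p)" by (rule supp_D)
  from Suc.IH[OF this] show ?case by (simp add: lookup_add lookup_ell_upto algebra_simps)
qed

lemma lmono_le_lookup_0:
  fixes \<beta> \<gamma> :: lmono
  assumes "\<beta> \<le> \<gamma>"
  shows "Poly_Mapping.lookup \<beta> 0 \<le> Poly_Mapping.lookup \<gamma> 0"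
proof (cases "\<beta> = \<gamma>")
  case False
  with assms have "\<beta> < \<gamma>" by simp
  then obtain i where i: "Poly_Mapping.lookup \<beta> i < Poly_Mapping.lookup \<gamma> i" "\<forall>j<i. Poly_Mapping.lookup \<beta> j = Poly_Mapping.lookup \<gamma> j"
    unfolding lmono_less_iff by blast
  then show ?thesis by (cases "i = 0") auto
qed simp

lemma supp_bounded:
  obtains N where "\<And>\<gamma>. \<gamma> \<in> supp p \<Longrightarrow> Poly_Mapping.lookup \<gamma> 0 \<le> N"
proof (cases "supp p = {}")
  case False
  then obtain m where "\<forall>b\<in>supp p. b \<le> m"
    using rev_wo_supp[of p] unfolding rev_wo_iff_max by blast
  then show thesis using that[of "Poly_Mapping.lookup m 0"] lmono_le_lookup_0 by blast
qed (use that in simp)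

lemma shift_fsummable: "fsummable (\<lambda>k. (m ^ k / fact k) *c (D ^^ k) p) UNIV"
proof -
  obtain N where N: "\<And>\<gamma>. \<gamma> \<in> supp p \<Longrightarrow> Poly_Mapping.lookup \<gamma> 0 \<le> N" using supp_bounded by blast
  have bound: "k \<le> nat (N - Poly_Mapping.lookup \<beta> 0)" if "\<beta> \<in> supp ((D ^^ k) p)" for k \<beta>
    using supp_D_pow[OF that] N by force
  have sub: "supp (c *c q) \<subseteq> supp q" for c q by (auto simp: supp_def)
  show ?thesis
  proof (rule fsummableI)
    fix \<beta>
    have "{k \<in> UNIV. mcoeff ((m ^ k / fact k) *c (D ^^ k) p) \<beta> \<noteq> 0} \<subseteq> {..nat (N - Poly_Mapping.lookup \<beta> 0)}"
      using bound by (auto simp: supp_def)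
    then show "finite {k \<in> UNIV. mcoeff ((m ^ k / fact k) *c (D ^^ k) p) \<beta> \<noteq> 0}"
      by (rule finite_subset) simp
  next
    have "wfp_on (\<Union>k. supp ((D ^^ k) p)) (>)"
      unfolding rev_wo_iff_seq
    proof
      assume "\<exists>s :: nat \<Rightarrow> lmono. strict_mono s \<and> range s \<subseteq> (\<Union>k. supp ((D ^^ k) p))"
      then obtain s :: "nat \<Rightarrow> lmono" where
        s: "strict_mono s" "range s \<subseteq> (\<Union>k. supp ((D ^^ k) p))" by blast
      have "range s \<subseteq> (\<Union>k\<le>nat (N - Poly_Mapping.lookup (s 0) 0). supp ((D ^^ k) p))"
      proof
        fix b assume "b \<in> range s"
        then obtain n where n: "b = s n" by blast
        with s(2) obtain k where k: "b \<in> supp ((D ^^ k) p)" by blast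
        have "s 0 \<le> b" using s(1) n by (simp add: strict_mono_less_eq)
        then have "nat (N - Poly_Mapping.lookup b 0) \<le> nat (N - Poly_Mapping.lookup (s 0) 0)"
          using lmono_le_lookup_0 by (intro nat_mono) simp
        with bound[OF k] have "k \<le> nat (N - Poly_Mapping.lookup (s 0) 0)" by simp
        with k show "b \<in> (\<Union>k\<le>nat (N - Poly_Mapping.lookup (s 0) 0). supp ((D ^^ k) p))" by blast
      qed
      moreover have "wfp_on (\<Union>k\<le>nat (N - Poly_Mapping.lookup (s 0) 0). supp ((D ^^ k) p)) (>)"
        by (rule rev_wo_UN) (simp_all add: rev_wo_supp)
      ultimately show False using s(1) unfolding rev_wo_iff_seq by blast
    qed
    then show "wfp_on (\<Union>k\<in>UNIV. supp ((m ^ k / fact k) *c (D ^^ k) p)) (>)"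
      by (rule rev_wo_mono) (use sub in blast)
  qed
qed

lemma has_fsum_shift: "has_fsum (\<lambda>k. (m ^ k / fact k) *c (D ^^ k) p) UNIV (shift m p)"
  unfolding shift_def by (rule has_fsum_fsum[OF shift_fsummable])

lemma shift_0 [simp]: "shift 0 p = p"
  unfolding shift_def
proof (rule fsum_eqI)
  have *: "{k. mcoeff ((0 ^ k / fact k) *c (D ^^ k) p) \<beta> \<noteq> 0} =
      (if mcoeff p \<beta> = 0 then {} else {0})" for \<beta>
    by (auto simp: power_0_left split: if_splits)
  show "has_fsum (\<lambda>k. (0 ^ k / fact k) *c (D ^^ k) p) UNIV p"
    unfolding has_fsum_def using * by simp
qed

section \<open>Some particular elements\<close>

definition const :: "complex \<Rightarrow> ila" where
  "const c = c *c lmonom 0"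

definition x_powi :: "int \<Rightarrow> ila" where
  "x_powi a = lmonom (Poly_Mapping.single 0 a)"

definition log_x :: ila where
  "log_x = lmonom (Poly_Mapping.single 1 1)"

definition x_log_x :: ila where
  "x_log_x = lmonom (Poly_Mapping.single 0 1 + Poly_Mapping.single 1 1)"

lemma D_x_powi: "D (x_powi a) = of_int a *c x_powi (a - 1)"
proof -
  have "Poly_Mapping.single 0 a - ell_upto 0 = Poly_Mapping.single 0 (a - 1)"
    by (simp add: ell_upto_def single_diff del: single_one)
  then show ?thesis
    by (cases "a = 0"; intro ila_eqI) (simp_all add: x_powi_def D_mono_def del: single_one)
qed

lemma D_log_x: "D log_x = x_powi (- 1)"
proof -
  have "Poly_Mapping.single 1 1 - ell_upto 1 = Poly_Mapping.single 0 (- 1 :: int)"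
    by (rule poly_mapping_eqI) (auto simp: lookup_minus lookup_ell_upto lookup_single when_def simp del: single_one)
  then show ?thesis
    by (intro ila_eqI) (simp add: log_x_def x_powi_def D_mono_def del: single_one)
qed

lemma D_x_log_x: "D x_log_x = log_x + const 1"
proof -
  define \<gamma> :: lmono where "\<gamma> = Poly_Mapping.single 0 1 + Poly_Mapping.single 1 1"
  have lookup: "Poly_Mapping.lookup \<gamma> j = (if j \<le> 1 then 1 else 0)" for j
    by (auto simp: \<gamma>_def lookup_add lookup_single when_def simp del: single_one)
  have keys: "Poly_Mapping.keys \<gamma> = {0, 1}"
    by (auto simp: in_keys_iff lookup split: if_splits)
  have diff_0: "\<gamma> - ell_upto 0 = Poly_Mapping.single 1 1"
    by (simp add: \<gamma>_def ell_upto_def del: single_one)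
  have diff_1: "\<gamma> - ell_upto 1 = 0"
    by (rule poly_mapping_eqI) (simp add: lookup_minus lookup lookup_ell_upto)
  have "D_mono \<gamma> = of_int (Poly_Mapping.lookup \<gamma> 0) *c lmonom (\<gamma> - ell_upto 0) +
      of_int (Poly_Mapping.lookup \<gamma> 1) *c lmonom (\<gamma> - ell_upto 1)"
    unfolding D_mono_def keys by simp
  then show ?thesis
    unfolding x_log_x_def \<gamma>_def[symmetric] D_mono_eq log_x_def const_def diff_0 diff_1 lookup
    by (intro ila_eqI) simp
qed

section \<open>Bernoulli numbers\<close>

text \<open>A formal power series in \<open>t\<close>, applied to a polynomial with \<open>t\<close> replaced by \<open>d/dx\<close>.\<close>

definition fps_op :: "complex fps \<Rightarrow> complex poly \<Rightarrow> complex poly" where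
  "fps_op F p = (\<Sum>j\<le>degree p. smult (F $ j) ((pderiv ^^ j) p))"

definition J_fps :: "complex fps" where
  "J_fps = (fps_exp 1 - 1) / fps_X"

definition bernoulli_poly :: "nat \<Rightarrow> complex poly" where
  "bernoulli_poly k = fps_op (inverse J_fps) (monom 1 k)"

definition bernoulli :: "nat \<Rightarrow> complex" where
  "bernoulli k = poly (bernoulli_poly k) 0"

lemma J_fps_nth: "J_fps $ j = 1 / fact (Suc j)"
  unfolding J_fps_def by (simp add: algebra_simps)

lemma coeff_fps_op:
  assumes "degree p \<le> N"
  shows "coeff (fps_op F p) i = (\<Sum>j\<le>N. F $ j * (pochhammer (of_nat (Suc i)) j * coeff p (i + j)))"
proof -
  have "coeff (fps_op F p) i = (\<Sum>j\<le>degree p. F $ j * (pochhammer (of_nat (Suc i)) j * coeff p (i + j)))"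
    by (simp add: fps_op_def coeff_sum coeff_higher_pderiv)
  also have "\<dots> = (\<Sum>j\<le>N. F $ j * (pochhammer (of_nat (Suc i)) j * coeff p (i + j)))"
    using assms by (intro sum.mono_neutral_left) (auto simp: coeff_eq_0)
  finally show ?thesis .
qed

lemma fps_op_mult: "fps_op (F * G) p = fps_op F (fps_op G p)"
proof (rule poly_eqI)
  fix i
  define N where "N = degree p"
  define c where "c s = pochhammer (of_nat (Suc i)) s * coeff p (i + s)" for s
  have c0: "c s = 0" if "s > N" for s using that by (simp add: c_def N_def coeff_eq_0)
  have deg: "degree (fps_op G p) \<le> N"
    by (rule degree_le) (auto simp: coeff_fps_op[of p N] N_def coeff_eq_0)
  have "coeff (fps_op F (fps_op G p)) i =
      (\<Sum>j\<le>N. \<Sum>l\<le>N. F $ j * G $ l * c (j + l))"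
    unfolding coeff_fps_op[OF deg] coeff_fps_op[of p N, OF eq_refl[OF N_def[symmetric]]]
  proof (simp only: sum_distrib_left, intro sum.cong refl)
    fix j l
    have "pochhammer (of_nat (Suc i)) (j + l) =
        (pochhammer (of_nat (Suc i)) j * pochhammer (of_nat (Suc (i + j))) l :: complex)"
      by (simp add: pochhammer_product' algebra_simps)
    then show "F $ j * (pochhammer (of_nat (Suc i)) j *
        (G $ l * (pochhammer (of_nat (Suc (i + j))) l * coeff p (i + j + l)))) = F $ j * G $ l * c (j + l)"
      by (simp add: c_def add.assoc)
  qed
  also have "\<dots> = (\<Sum>j\<le>N. \<Sum>l\<le>N - j. F $ j * G $ l * c (j + l))"
    by (intro sum.cong refl sum.mono_neutral_right) (auto simp: c0)
  also have "\<dots> = (\<Sum>(j, l)\<in>(SIGMA j:{..N}. {..N - j}). F $ j * G $ l * c (j + l))"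
    by (simp add: sum.Sigma)
  also have "\<dots> = (\<Sum>(s, j)\<in>(SIGMA s:{..N}. {0..s}). F $ j * G $ (s - j) * c s)"
    by (rule sum.reindex_bij_witness[of _ "\<lambda>(s, j). (j, s - j)" "\<lambda>(j, l). (j + l, j)"]) auto
  also have "\<dots> = (\<Sum>s\<le>N. (F * G) $ s * c s)"
    by (simp add: sum.Sigma[symmetric] fps_mult_nth sum_distrib_right)
  also have "\<dots> = coeff (fps_op (F * G) p) i"
    by (simp add: coeff_fps_op[of p N] N_def c_def)
  finally show "coeff (fps_op (F * G) p) i = coeff (fps_op F (fps_op G p)) i" ..
qed

lemma J_bernoulli_poly: "fps_op J_fps (bernoulli_poly k) = monom 1 k"
proof -
  have "J_fps * inverse J_fps = 1" by (rule inverse_mult_eq_1') (simp add: J_fps_nth)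
  then have "fps_op J_fps (bernoulli_poly k) = fps_op 1 (monom 1 k)"
    by (simp add: bernoulli_poly_def fps_op_mult[symmetric])
  also have "\<dots> = (\<Sum>j\<le>k. if j = 0 then monom 1 k else 0)"
    unfolding fps_op_def by (intro sum.cong) (auto simp: degree_monom_eq)
  also have "\<dots> = monom 1 k" by simp
  finally show ?thesis .
qed

lemma bernoulli_altdef: "bernoulli k = fact k * inverse J_fps $ k"
  by (simp add: bernoulli_def bernoulli_poly_def poly_0_coeff_0 degree_monom_eq
      coeff_fps_op[of _ k] pochhammer_fact[symmetric] if_distrib cong: if_cong)

lemma bernoulli_fps: "Abs_fps (\<lambda>k. bernoulli k / fact k) = fps_X / (fps_exp 1 - 1)"
proof -
  have eq: "fps_exp 1 - 1 = fps_X * J_fps"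
    by (rule fps_ext) (auto simp: J_fps_nth fps_X_mult_nth)
  have "fps_X / (fps_X * J_fps) = 1 / J_fps"
    by (metis div_mult_mult1 fps_X_neq_zero mult.right_neutral)
  also have "\<dots> = inverse J_fps"
    by (simp add: fps_divide_unit J_fps_nth)
  finally have "fps_X / (fps_exp 1 - 1) = inverse J_fps" unfolding eq .
  then show ?thesis by (auto simp: fps_eq_iff bernoulli_altdef)
qed

end

theory Submission
  imports Defs
begin

text \<open>
  Formal power series in \<open>D\<close> act on the algebra, compatibly with multiplication, and the shift by
  \<open>m\<close> is the action of \<open>e\<^sup>m\<^sup>D\<close>.  Put \<open>g = x log x - x\<close>, so that \<open>D g = log x\<close>, and
  \<open>N = n + 1\<close>.  The left-hand side is the action of \<open>D (1 + e\<^sup>D + \<dots> + e\<^sup>n\<^sup>D)\<close> on \<open>g\<close>, and this operator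
  equals \<open>J\<inverse> (e\<^sup>N\<^sup>D - 1)\<close> by the geometric series.  Expanding \<open>J\<inverse> = \<Sum> B\<^sub>k D\<^sup>k / k!\<close>, applied to
  \<open>g(x + N) - g(x)\<close>, gives the right-hand side.
\<close>

section \<open>The derivative as a linear operator\<close>

lemma D_mono_finite: "finite {\<gamma>. mcoeff p \<gamma> \<noteq> 0 \<and> mcoeff (D_mono \<gamma>) \<beta> \<noteq> 0}"
  using has_fsum_D[of p] unfolding has_fsum_def by simp

text \<open>Indices outside the support contribute zero, so any finite superset \<open>T\<close>
  serves as index set. This allows several series to be summed over one common \<open>T\<close>,
  which gives linearity of \<open>D\<close>.\<close>

lemma mcoeff_D:
  assumes "finite T" "{\<gamma>. mcoeff p \<gamma> \<noteq> 0 \<and> mcoeff (D_mono \<gamma>) \<beta> \<noteq> 0} \<subseteq> T"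
  shows "mcoeff (D p) \<beta> = (\<Sum>\<gamma>\<in>T. mcoeff p \<gamma> * mcoeff (D_mono \<gamma>) \<beta>)"
proof -
  have "mcoeff (D p) \<beta> = (\<Sum>\<gamma> | mcoeff p \<gamma> \<noteq> 0 \<and> mcoeff (D_mono \<gamma>) \<beta> \<noteq> 0.
      mcoeff p \<gamma> * mcoeff (D_mono \<gamma>) \<beta>)"
    using has_fsum_D[of p] unfolding has_fsum_def by simp
  also have "\<dots> = (\<Sum>\<gamma>\<in>T. mcoeff p \<gamma> * mcoeff (D_mono \<gamma>) \<beta>)"
    using assms by (intro sum.mono_neutral_left) auto
  finally show ?thesis .
qed

lemma D_add: "D (p + q) = D p + D q"
proof (rule ila_eqI)
  fix \<beta>
  let ?T = "{\<gamma>. mcoeff p \<gamma> \<noteq> 0 \<and> mcoeff (D_mono \<gamma>) \<beta> \<noteq> 0} \<union>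
    {\<gamma>. mcoeff q \<gamma> \<noteq> 0 \<and> mcoeff (D_mono \<gamma>) \<beta> \<noteq> 0}"
  have T: "finite ?T" by (simp add: D_mono_finite)
  have "mcoeff (D p) \<beta> = (\<Sum>\<gamma>\<in>?T. mcoeff p \<gamma> * mcoeff (D_mono \<gamma>) \<beta>)"
    by (rule mcoeff_D[OF T]) auto
  moreover have "mcoeff (D q) \<beta> = (\<Sum>\<gamma>\<in>?T. mcoeff q \<gamma> * mcoeff (D_mono \<gamma>) \<beta>)"
    by (rule mcoeff_D[OF T]) auto
  moreover have "mcoeff (D (p + q)) \<beta> = (\<Sum>\<gamma>\<in>?T. mcoeff (p + q) \<gamma> * mcoeff (D_mono \<gamma>) \<beta>)"
    by (rule mcoeff_D[OF T]) auto
  ultimately show "mcoeff (D (p + q)) \<beta> = mcoeff (D p + D q) \<beta>"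
    by (simp add: distrib_right sum.distrib)
qed

lemma D_cscale: "D (c *c p) = c *c D p"
proof (rule ila_eqI)
  fix \<beta>
  let ?T = "{\<gamma>. mcoeff p \<gamma> \<noteq> 0 \<and> mcoeff (D_mono \<gamma>) \<beta> \<noteq> 0}"
  have "mcoeff (D (c *c p)) \<beta> = (\<Sum>\<gamma>\<in>?T. mcoeff (c *c p) \<gamma> * mcoeff (D_mono \<gamma>) \<beta>)"
    by (rule mcoeff_D[OF D_mono_finite]) auto
  moreover have "mcoeff (D p) \<beta> = (\<Sum>\<gamma>\<in>?T. mcoeff p \<gamma> * mcoeff (D_mono \<gamma>) \<beta>)"
    by (rule mcoeff_D[OF D_mono_finite]) auto
  ultimately show "mcoeff (D (c *c p)) \<beta> = mcoeff (c *c D p) \<beta>"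
    by (simp add: sum_distrib_left mult.assoc)
qed

lemma D_zero: "D 0 = 0"
  using D_add[of 0 0] by simp

lemma D_diff: "D (p - q) = D p - D q"
  using D_add[of "p - q" q] by (simp add: algebra_simps)

lemma D_sum: "D (sum f A) = (\<Sum>i\<in>A. D (f i))"
  by (induction A rule: infinite_finite_induct) (simp_all add: D_zero D_add)

lemma D_pow_diff: "(D ^^ k) (p - q) = (D ^^ k) p - (D ^^ k) q"
  by (induction k) (simp_all add: D_diff)

lemma D_pow_cscale: "(D ^^ k) (c *c p) = c *c (D ^^ k) p"
  by (induction k) (simp_all add: D_cscale)

text \<open>Every \<open>ell_upto i\<close> has entry 1 at index 0, so \<open>D\<close> lowers the
  exponent of x by exactly one. A coefficient of \<open>D p\<close> therefore reads only the layer
  of \<open>p\<close> one x-exponent higher.\<close>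

lemma mcoeff_D_cong:
  assumes "\<And>\<gamma>. Poly_Mapping.lookup \<gamma> 0 = Poly_Mapping.lookup \<beta> 0 + 1 \<Longrightarrow> mcoeff p \<gamma> = mcoeff q \<gamma>"
  shows "mcoeff (D p) \<beta> = mcoeff (D q) \<beta>"
proof (rule ccontr)
  assume "mcoeff (D p) \<beta> \<noteq> mcoeff (D q) \<beta>"
  then have "\<beta> \<in> supp (D (p - q))" by (simp add: supp_def D_diff)
  then obtain i where "\<beta> + ell_upto i \<in> supp (p - q)" by (rule supp_D)
  then show False using assms[of "\<beta> + ell_upto i"]
    by (simp add: supp_def lookup_add lookup_ell_upto)
qed

section \<open>Power series in the derivative\<close>

text \<open>The x-exponents of \<open>p\<close> are bounded above because its support is reverse
  well-ordered, and each derivative lowers them by one. The same \<open>N\<close> serves all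
  \<open>k\<close> and \<open>\<beta>\<close>.\<close>

lemma D_pow_vanishes:
  obtains N where "\<And>k \<beta>. N - Poly_Mapping.lookup \<beta> 0 < int k \<Longrightarrow> mcoeff ((D ^^ k) p) \<beta> = 0"
proof -
  obtain N where N: "\<And>\<gamma>. \<gamma> \<in> supp p \<Longrightarrow> Poly_Mapping.lookup \<gamma> 0 \<le> N"
    using supp_bounded by blast
  have "mcoeff ((D ^^ k) p) \<beta> = 0" if "N - Poly_Mapping.lookup \<beta> 0 < int k" for k \<beta>
  proof (rule ccontr)
    assume "mcoeff ((D ^^ k) p) \<beta> \<noteq> 0"
    then obtain \<gamma> where "\<gamma> \<in> supp p" "Poly_Mapping.lookup \<beta> 0 + int k = Poly_Mapping.lookup \<gamma> 0"
      using supp_D_pow[of \<beta> k p] by (auto simp: supp_def)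
    then show False using N[of \<gamma>] that by simp
  qed
  then show thesis using that by blast
qed

text \<open>Only the elements of \<open>B\<close> above a fixed \<open>b\<close> matter for a
  maximum. Their x-exponents are at least that of \<open>b\<close>, so they come from finitely many
  derivatives, and a finite union of reverse well-ordered sets is reverse well-ordered.\<close>

lemma rev_wo_supp_D_pow: "wfp_on (\<Union>k. supp ((D ^^ k) p)) (>)"
  unfolding rev_wo_iff_max
proof (intro allI impI)
  fix B assume B: "B \<subseteq> (\<Union>k. supp ((D ^^ k) p))" "B \<noteq> {}"
  then obtain b where b: "b \<in> B" by blast
  obtain N where N: "\<And>k \<beta>. N - Poly_Mapping.lookup \<beta> 0 < int k \<Longrightarrow> mcoeff ((D ^^ k) p) \<beta> = 0"
    using D_pow_vanishes[of p] by blast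
  let ?K = "nat (N - Poly_Mapping.lookup b 0)" and ?C = "{c \<in> B. b \<le> c}"
  have "?C \<subseteq> (\<Union>k\<le>?K. supp ((D ^^ k) p))"
  proof
    fix c assume c: "c \<in> ?C"
    then obtain k where k: "c \<in> supp ((D ^^ k) p)" using B(1) by blast
    have "\<not> N - Poly_Mapping.lookup c 0 < int k" using k N[of c k] by (auto simp: supp_def)
    moreover have "Poly_Mapping.lookup b 0 \<le> Poly_Mapping.lookup c 0"
      using c lmono_le_lookup_0 by simp
    ultimately have "k \<le> ?K" by linarith
    with k show "c \<in> (\<Union>k\<le>?K. supp ((D ^^ k) p))" by blast
  qed
  moreover have "wfp_on (\<Union>k\<le>?K. supp ((D ^^ k) p)) (>)"
    by (rule rev_wo_UN) (simp_all add: rev_wo_supp)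
  moreover have "?C \<noteq> {}" using b by blast
  ultimately have "\<exists>m\<in>?C. \<forall>c\<in>?C. c \<le> m"
    unfolding rev_wo_iff_max by meson
  then obtain m where m: "m \<in> ?C" "\<And>c. c \<in> ?C \<Longrightarrow> c \<le> m"
    by blast
  have "c \<le> m" if "c \<in> B" for c
  proof (cases "b \<le> c")
    case True
    then show ?thesis using m(2) that by blast
  next
    case False
    then show ?thesis using m(1) by auto
  qed
  then show "\<exists>m\<in>B. \<forall>b\<in>B. b \<le> m" using m(1) by blast
qed

section \<open>The action of F(D) and its algebraic laws\<close>

definition ila_op :: "complex fps \<Rightarrow> ila \<Rightarrow> ila" where
  "ila_op F p = fsum (\<lambda>k. (F $ k) *c (D ^^ k) p) UNIV"

lemma ila_op_fsummable: "fsummable (\<lambda>k. (F $ k) *c (D ^^ k) p) UNIV"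
proof (rule fsummableI)
  fix \<beta>
  obtain N where N: "\<And>k \<beta>. N - Poly_Mapping.lookup \<beta> 0 < int k \<Longrightarrow> mcoeff ((D ^^ k) p) \<beta> = 0"
    using D_pow_vanishes[of p] by blast
  have "{k \<in> UNIV. mcoeff ((F $ k) *c (D ^^ k) p) \<beta> \<noteq> 0} \<subseteq> {..nat (N - Poly_Mapping.lookup \<beta> 0)}"
    using N[of \<beta>] by force
  then show "finite {k \<in> UNIV. mcoeff ((F $ k) *c (D ^^ k) p) \<beta> \<noteq> 0}"
    by (rule finite_subset) simp
next
  show "wfp_on (\<Union>k\<in>UNIV. supp ((F $ k) *c (D ^^ k) p)) (>)"
    by (rule rev_wo_mono[OF rev_wo_supp_D_pow[of p]]) (auto simp: supp_def)
qed

lemma has_fsum_ila_op: "has_fsum (\<lambda>k. (F $ k) *c (D ^^ k) p) UNIV (ila_op F p)"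
  unfolding ila_op_def by (rule has_fsum_fsum[OF ila_op_fsummable])

lemma mcoeff_ila_op:
  assumes "\<And>k. k > K \<Longrightarrow> mcoeff ((D ^^ k) p) \<beta> = 0"
  shows "mcoeff (ila_op F p) \<beta> = (\<Sum>k\<le>K. F $ k * mcoeff ((D ^^ k) p) \<beta>)"
proof -
  have "mcoeff (ila_op F p) \<beta> = (\<Sum>k | mcoeff ((F $ k) *c (D ^^ k) p) \<beta> \<noteq> 0. mcoeff ((F $ k) *c (D ^^ k) p) \<beta>)"
    using has_fsum_ila_op[of F p] by (simp add: has_fsum_def)
  also have "\<dots> = (\<Sum>k\<le>K. mcoeff ((F $ k) *c (D ^^ k) p) \<beta>)"
    using assms by (intro sum.mono_neutral_left) (auto simp: not_less[symmetric])
  finally show ?thesis by simp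
qed

text \<open>The bound \<open>K\<close> is uniform over all monomials of x-exponent at least
  \<open>b\<close>. This uniformity is what lets an infinite sum be truncated before
  \<open>D\<close> is applied, since \<open>D\<close> may read many monomials of one layer.\<close>

lemma mcoeff_D_pow_eventually:
  obtains K where "\<And>k \<gamma>. Poly_Mapping.lookup \<gamma> 0 \<ge> b \<Longrightarrow> k > K \<Longrightarrow> mcoeff ((D ^^ k) p) \<gamma> = 0"
proof -
  obtain N where N: "\<And>k \<beta>. N - Poly_Mapping.lookup \<beta> 0 < int k \<Longrightarrow> mcoeff ((D ^^ k) p) \<beta> = 0"
    using D_pow_vanishes[of p] by blast
  show thesis by (rule that[of "nat (N - b)"]) (rule N, linarith)
qed

lemma mcoeff_D_pow_eventually_at:
  obtains K where "\<And>k. k > K \<Longrightarrow> mcoeff ((D ^^ k) p) \<beta> = 0"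
proof -
  obtain K where "\<And>k \<gamma>. Poly_Mapping.lookup \<gamma> 0 \<ge> Poly_Mapping.lookup \<beta> 0 \<Longrightarrow> k > K \<Longrightarrow>
      mcoeff ((D ^^ k) p) \<gamma> = 0"
    using mcoeff_D_pow_eventually by blast
  then show thesis using that by blast
qed

text \<open>Commuting \<open>D\<close> with the infinite sum is a matter of truncation: at
  \<open>\<beta>\<close> the operator \<open>D\<close> sees only monomials of the next higher layer,
  where all terms beyond \<open>K\<close> vanish. Finite sums commute with \<open>D\<close> by
  linearity.\<close>

lemma ila_op_D: "ila_op F (D p) = D (ila_op F p)"
proof (rule ila_eqI)
  fix \<beta> :: lmono
  obtain K where K: "\<And>k \<gamma>. Poly_Mapping.lookup \<gamma> 0 \<ge> Poly_Mapping.lookup \<beta> 0 \<Longrightarrow> k > K \<Longrightarrow>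
      mcoeff ((D ^^ k) p) \<gamma> = 0"
    using mcoeff_D_pow_eventually by blast
  have comm: "(D ^^ k) (D p) = D ((D ^^ k) p)" for k by (simp add: funpow_swap1)
  have "mcoeff (D (ila_op F p)) \<beta> = mcoeff (D (\<Sum>k\<le>K. (F $ k) *c (D ^^ k) p)) \<beta>"
  proof (rule mcoeff_D_cong)
    fix \<gamma> :: lmono assume "Poly_Mapping.lookup \<gamma> 0 = Poly_Mapping.lookup \<beta> 0 + 1"
    then show "mcoeff (ila_op F p) \<gamma> = mcoeff (\<Sum>k\<le>K. (F $ k) *c (D ^^ k) p) \<gamma>"
      using K[of \<gamma>] by (simp add: mcoeff_ila_op[of K])
  qed
  also have "\<dots> = (\<Sum>k\<le>K. F $ k * mcoeff (D ((D ^^ k) p)) \<beta>)"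
    by (simp add: D_sum D_cscale)
  also have "\<dots> = mcoeff (ila_op F (D p)) \<beta>"
  proof -
    have "mcoeff ((D ^^ k) (D p)) \<beta> = 0" if "k > K" for k
      using K[of \<beta> "Suc k"] that by (simp add: comm)
    then show ?thesis by (subst mcoeff_ila_op[of K]) (simp_all add: comm)
  qed
  finally show "mcoeff (ila_op F (D p)) \<beta> = mcoeff (D (ila_op F p)) \<beta>" ..
qed

lemma ila_op_D_pow: "ila_op F ((D ^^ k) p) = (D ^^ k) (ila_op F p)"
  by (induction k) (simp_all add: ila_op_D)

text \<open>At a fixed monomial both sides are finite sums over the triangle
  \<open>k + l \<le> K\<close>; collecting by \<open>s = k + l\<close> produces the Cauchy product
  coefficients.\<close>

lemma ila_op_mult: "ila_op (F * G) p = ila_op F (ila_op G p)"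
proof (rule ila_eqI)
  fix \<beta>
  obtain K where K: "\<And>k. k > K \<Longrightarrow> mcoeff ((D ^^ k) p) \<beta> = 0"
    using mcoeff_D_pow_eventually_at by blast
  have pow: "(D ^^ k) (ila_op G p) = ila_op G ((D ^^ k) p)" for k
    by (simp add: ila_op_D_pow)
  have add: "(D ^^ l) ((D ^^ k) p) = (D ^^ (k + l)) p" for k l
    by (metis funpow_add comp_apply add.commute)
  \<comment> \<open>Since \<open>k\<close> derivatives are already used up, the cutoff drops to
    \<open>K - k\<close>. For \<open>k > K\<close> the truncated subtraction leaves only
    \<open>l = 0\<close>, whose term vanishes too, so the outer sum may also stop at
    \<open>K\<close>.\<close>
  have inner: "mcoeff (ila_op G ((D ^^ k) p)) \<beta> =
      (\<Sum>l\<le>K - k. G $ l * mcoeff ((D ^^ (k + l)) p) \<beta>)" for k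
    unfolding add[symmetric] by (rule mcoeff_ila_op) (simp add: add K)
  have "mcoeff (ila_op F (ila_op G p)) \<beta> =
      (\<Sum>k\<le>K. F $ k * mcoeff (ila_op G ((D ^^ k) p)) \<beta>)"
    unfolding pow[symmetric] by (rule mcoeff_ila_op) (simp add: pow inner K)
  also have "\<dots> = (\<Sum>k\<le>K. \<Sum>l\<le>K - k. F $ k * G $ l * mcoeff ((D ^^ (k + l)) p) \<beta>)"
    by (simp add: inner sum_distrib_left mult.assoc)
  also have "\<dots> = (\<Sum>(k, l)\<in>{(k, l). k + l \<le> K}. F $ k * G $ l * mcoeff ((D ^^ (k + l)) p) \<beta>)"
    by (subst sum.Sigma) (auto intro: sum.cong)
  also have "\<dots> = (\<Sum>s\<le>K. (F * G) $ s * mcoeff ((D ^^ s) p) \<beta>)"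
    by (simp add: sum.triangle_reindex_eq fps_mult_nth sum_distrib_right atLeast0AtMost)
  also have "\<dots> = mcoeff (ila_op (F * G) p) \<beta>"
    by (rule mcoeff_ila_op[symmetric]) (rule K)
  finally show "mcoeff (ila_op (F * G) p) \<beta> = mcoeff (ila_op F (ila_op G p)) \<beta>" ..
qed

lemma ila_op_add: "ila_op (F + G) p = ila_op F p + ila_op G p"
proof (rule ila_eqI)
  fix \<beta>
  obtain K where K: "\<And>k. k > K \<Longrightarrow> mcoeff ((D ^^ k) p) \<beta> = 0"
    using mcoeff_D_pow_eventually_at by blast
  show "mcoeff (ila_op (F + G) p) \<beta> = mcoeff (ila_op F p + ila_op G p) \<beta>"
    by (simp add: mcoeff_ila_op[OF K] distrib_right sum.distrib)
qed

lemma ila_op_diff: "ila_op (F - G) p = ila_op F p - ila_op G p"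
  using ila_op_add[of "F - G" G p] by (simp add: algebra_simps)

lemma ila_op_sum: "ila_op (sum F A) p = (\<Sum>i\<in>A. ila_op (F i) p)"
proof (induction A rule: infinite_finite_induct)
  case empty
  \<comment> \<open>Writing 0 as 0 - 0 shows that the zero series acts as zero.\<close>
  show ?case using ila_op_diff[of 0 0 p] by simp
next
  case (infinite A)
  then show ?case using ila_op_diff[of 0 0 p] by simp
qed (simp_all add: ila_op_add)

lemma ila_op_fps_X: "ila_op fps_X p = D p"
  unfolding ila_op_def
proof (rule fsum_eqI)
  have *: "{k. mcoeff ((fps_X $ k) *c (D ^^ k) p) \<beta> \<noteq> 0} =
      (if mcoeff (D p) \<beta> = 0 then {} else {1})" for \<beta>
    by (auto simp: fps_X_def)
  show "has_fsum (\<lambda>k. (fps_X $ k) *c (D ^^ k) p) UNIV (D p)"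
    unfolding has_fsum_def using * by simp
qed

section \<open>Shifts\<close>

lemma shift_eq_ila_op: "shift m p = ila_op (fps_exp m) p"
  by (simp add: shift_def ila_op_def)

lemma shift_minus_id: "shift m p - p = ila_op (fps_exp m - 1) p"
proof -
  have "ila_op 1 p = p"
    \<comment> \<open>The series 1 is \<open>fps_exp 0\<close>, the shift by 0, so it acts as the
      identity.\<close>
    using shift_eq_ila_op[of 0 p] by simp
  then show ?thesis by (simp add: ila_op_diff shift_eq_ila_op)
qed

lemma shift_diff: "shift m (p - q) = shift m p - shift m q"
proof (rule ila_eqI)
  fix \<beta>
  obtain K where K: "\<And>k. k > K \<Longrightarrow> mcoeff ((D ^^ k) p) \<beta> = 0"
    using mcoeff_D_pow_eventually_at by blast
  obtain L where L: "\<And>k. k > L \<Longrightarrow> mcoeff ((D ^^ k) q) \<beta> = 0"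
    using mcoeff_D_pow_eventually_at by blast
  show "mcoeff (shift m (p - q)) \<beta> = mcoeff (shift m p - shift m q) \<beta>"
    unfolding shift_eq_ila_op
    by (simp add: mcoeff_ila_op[of "max K L"] K L D_pow_diff right_diff_distrib sum_subtractf)
qed

lemma shift_cscale: "shift m (c *c p) = c *c shift m p"
proof (rule ila_eqI)
  fix \<beta>
  obtain K where K: "\<And>k. k > K \<Longrightarrow> mcoeff ((D ^^ k) p) \<beta> = 0"
    using mcoeff_D_pow_eventually_at by blast
  show "mcoeff (shift m (c *c p)) \<beta> = mcoeff (c *c shift m p) \<beta>"
    unfolding shift_eq_ila_op
    by (simp add: mcoeff_ila_op[of K] K D_pow_cscale sum_distrib_left mult.left_commute)
qed

text \<open>The difference operator is itself a power series in \<open>D\<close>, namely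
  \<open>fps_exp m - 1\<close>, hence commutes with \<open>D\<close>.\<close>

lemma D_pow_shift_minus_id: "(D ^^ k) (shift m p - p) = shift m ((D ^^ k) p) - (D ^^ k) p"
  by (simp add: shift_minus_id ila_op_D_pow)

lemma D_x: "D (x_powi 1) = const 1"
  unfolding D_x_powi const_def by (simp add: x_powi_def)

text \<open>The Taylor expansion stops after the linear term because the second derivative of x is
  zero.\<close>

lemma shift_x: "shift m (x_powi 1) = x_powi 1 + const m"
proof (rule ila_eqI)
  fix \<beta>
  \<comment> \<open>The constant 1 is the zeroth power of x, so the power rule gives the factor
    0.\<close>
  have "D (const 1) = 0"
    using D_x_powi[of 0] by (intro ila_eqI) (simp add: const_def x_powi_def D_cscale)
  then have D2: "(D ^^ Suc (Suc k)) (x_powi 1) = 0" for k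
    by (induction k) (simp_all add: D_x D_zero)
  have vanish: "(D ^^ k) (x_powi 1) = 0" if "k > 1" for k
    using D2[of "k - 2"] that by (simp only: Suc_diff_Suc numeral_2_eq_2 diff_Suc_Suc) simp
  show "mcoeff (shift m (x_powi 1)) \<beta> = mcoeff (x_powi 1 + const m) \<beta>"
    unfolding shift_eq_ila_op
    by (subst mcoeff_ila_op[of 1]) (simp_all add: vanish D_x const_def)
qed

section \<open>The antiderivative of the logarithm\<close>

definition log_prim :: ila where
  "log_prim = x_log_x - x_powi 1"

lemma D_log_prim: "D log_prim = log_x"
  by (rule ila_eqI) (simp add: log_prim_def D_diff D_x_log_x D_x)

text \<open>Two derivatives lead from \<open>log_prim\<close> through \<open>log_x\<close> to 1/x;
  each further one contributes a factor \<open>- (k + 1)\<close>. This is the origin of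
  \<open>(k - 2)!\<close> in the formula, and the sign survives the reindexing because the offset 2
  is even.\<close>

lemma D_pow_log_prim: "(D ^^ (k + 2)) log_prim = ((- 1) ^ k * fact k) *c x_powi (- int (k + 1))"
proof (induction k)
  case 0
  show ?case by (rule ila_eqI) (simp add: numeral_2_eq_2 D_log_prim D_log_x)
next
  case (Suc k)
  have "(D ^^ (Suc k + 2)) log_prim = D ((D ^^ (k + 2)) log_prim)" by simp
  also have "\<dots> = ((- 1) ^ k * fact k) *c D (x_powi (- int (k + 1)))"
    unfolding Suc.IH D_cscale ..
  also have "\<dots> = ((- 1) ^ Suc k * fact (Suc k)) *c x_powi (- int (Suc k + 1))"
    by (rule ila_eqI) (simp add: D_x_powi algebra_simps)
  finally show ?case .
qed

text \<open>The summand -x of \<open>log_prim\<close> changes by -m under the shift; with m = n + 1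
  this yields the term -n-1 next to \<open>bernoulli 0\<close>.\<close>

lemma shift_log_prim_minus_id:
  "shift m log_prim - log_prim = shift m x_log_x - x_log_x - const m"
  by (simp add: log_prim_def shift_diff shift_x)

section \<open>Stirling's formula\<close>

text \<open>Substitute \<open>fps_X * J_fps\<close> for \<open>fps_exp 1 - 1\<close> in the
  geometric sum of the powers of \<open>fps_exp 1\<close>, then cancel \<open>J_fps\<close>, which
  is a unit because its constant term is 1.\<close>

lemma geometric_sum_J:
  "fps_X * (\<Sum>j<N. fps_exp (of_nat j)) = inverse J_fps * (fps_exp (of_nat N) - 1)"
proof -
  have J: "fps_X * J_fps = fps_exp 1 - 1"
    by (rule fps_ext) (auto simp: J_fps_nth fps_X_mult_nth)
  have inv: "inverse J_fps * J_fps = 1" by (rule inverse_mult_eq_1) (simp add: J_fps_nth)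
  have "fps_exp (of_nat N) - 1 = (fps_exp 1 - 1) * (\<Sum>j<N. fps_exp (of_nat j) :: complex fps)"
    using power_diff_1_eq[of "fps_exp 1 :: complex fps" N] by (simp add: fps_exp_power_mult)
  also have "\<dots> = J_fps * (fps_X * (\<Sum>j<N. fps_exp (of_nat j)))"
    by (simp add: J[symmetric] mult_ac)
  finally have "inverse J_fps * (fps_exp (of_nat N) - 1) =
      (inverse J_fps * J_fps) * (fps_X * (\<Sum>j<N. fps_exp (of_nat j)))"
    by (simp only: mult.assoc)
  then show ?thesis by (simp add: inv)
qed

text \<open>This is Euler-Maclaurin summation in operator form. It is exact, with no remainder term,
  because the series in \<open>D\<close> converges coefficientwise.\<close>

lemma sum_shift_D:
  "(\<Sum>j<N. shift (of_nat j) (D p)) = ila_op (inverse J_fps) (shift (of_nat N) p - p)"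
proof -
  have "(\<Sum>j<N. shift (of_nat j) (D p)) = D (ila_op (\<Sum>j<N. fps_exp (of_nat j)) p)"
    by (simp add: shift_eq_ila_op ila_op_D D_sum ila_op_sum)
  also have "\<dots> = ila_op (fps_X * (\<Sum>j<N. fps_exp (of_nat j))) p"
    by (simp add: ila_op_mult ila_op_fps_X)
  finally show ?thesis by (simp add: geometric_sum_J ila_op_mult shift_minus_id)
qed

section \<open>Splitting and rewriting coefficientwise sums\<close>

lemma has_fsum_tail:
  fixes f :: "nat \<Rightarrow> ila"
  assumes "has_fsum f UNIV S"
  shows "has_fsum f {m..} (S - (\<Sum>k<m. f k))"
  unfolding has_fsum_def
proof (intro allI conjI)
  fix \<gamma> :: lmono
  let ?U = "{k. mcoeff (f k) \<gamma> \<noteq> 0}" and ?T = "{k \<in> {m..}. mcoeff (f k) \<gamma> \<noteq> 0}"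
  have U: "finite ?U" and S: "mcoeff S \<gamma> = (\<Sum>k\<in>?U. mcoeff (f k) \<gamma>)"
    using assms by (simp_all add: has_fsum_def)
  show T: "finite ?T" by (rule finite_subset[OF _ U]) auto
  \<comment> \<open>All head indices are put into the index set, including those with zero
    coefficient, so that the head becomes a plain sum over \<open>k < m\<close>.\<close>
  have "mcoeff S \<gamma> = (\<Sum>k\<in>{..<m} \<union> ?T. mcoeff (f k) \<gamma>)"
    unfolding S using T by (intro sum.mono_neutral_left) (auto simp: not_less)
  also have "\<dots> = (\<Sum>k<m. mcoeff (f k) \<gamma>) + (\<Sum>k\<in>?T. mcoeff (f k) \<gamma>)"
    using T by (intro sum.union_disjoint) auto
  finally show "mcoeff (S - (\<Sum>k<m. f k)) \<gamma> = (\<Sum>k | k \<in> {m..} \<and> mcoeff (f k) \<gamma> \<noteq> 0. mcoeff (f k) \<gamma>)"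
    by simp
qed

lemma has_fsum_cong:
  assumes "\<And>i. i \<in> A \<Longrightarrow> f i = g i"
  shows "has_fsum f A S \<longleftrightarrow> has_fsum g A S"
proof -
  have "{i. i \<in> A \<and> mcoeff (f i) \<gamma> \<noteq> 0} = {i. i \<in> A \<and> mcoeff (g i) \<gamma> \<noteq> 0}" for \<gamma>
    using assms by auto
  moreover have "(\<Sum>i | i \<in> A \<and> mcoeff (g i) \<gamma> \<noteq> 0. mcoeff (f i) \<gamma>) =
      (\<Sum>i | i \<in> A \<and> mcoeff (g i) \<gamma> \<noteq> 0. mcoeff (g i) \<gamma>)" for \<gamma>
    using assms by (intro sum.cong) auto
  ultimately show ?thesis by (simp add: has_fsum_def)
qed

theorem mainTheorem7:
  fixes n :: nat
  shows "fsummable (\<lambda>k. (bernoulli k / fact k * (-1) ^ k * fact (k - 2)) *c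
             (shift (of_nat (n + 1)) (x_powi (- int (k - 1))) - x_powi (- int (k - 1)))) {2..} \<and>
         (\<Sum>j\<le>n. shift (of_nat j) log_x) =
           bernoulli 0 *c (shift (of_nat (n + 1)) x_log_x - x_log_x - const (of_nat (n + 1)))
         + bernoulli 1 *c (shift (of_nat (n + 1)) log_x - log_x)
         + fsum (\<lambda>k. (bernoulli k / fact k * (-1) ^ k * fact (k - 2)) *c
             (shift (of_nat (n + 1)) (x_powi (- int (k - 1))) - x_powi (- int (k - 1)))) {2..}"
proof -
  let ?h = "shift (of_nat (n + 1)) log_prim - log_prim"
  let ?f = "\<lambda>k. (inverse J_fps $ k) *c (D ^^ k) ?h"
  let ?g = "\<lambda>k. (bernoulli k / fact k * (-1) ^ k * fact (k - 2)) *c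
    (shift (of_nat (n + 1)) (x_powi (- int (k - 1))) - x_powi (- int (k - 1)))"
  define L where "L = (\<Sum>j\<le>n. shift (of_nat j) log_x)"
  \<comment> \<open>Euler-Maclaurin applies with \<open>p = log_prim\<close>, whose derivative is
    \<open>log_x\<close>, and with \<open>n + 1\<close> summands
    \<open>j = 0, ..., n\<close>.\<close>
  have "L = ila_op (inverse J_fps) ?h"
    using sum_shift_D[of log_prim "n + 1"] by (simp add: L_def D_log_prim lessThan_Suc_atMost)
  then have "has_fsum ?f {2..} (L - (\<Sum>k<2. ?f k))"
    by (simp only:) (rule has_fsum_tail[OF has_fsum_ila_op])
  \<comment> \<open>From \<open>k = 2\<close> on, \<open>D\<close> has removed all logarithms from
    \<open>log_prim\<close>. With \<open>i = k - 2\<close> the k-th derivative gives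
    \<open>(-1)^i * i!\<close>, and \<open>(-1)^i = (-1)^k\<close>.\<close>
  moreover have "?f k = ?g k" if "k \<in> {2..}" for k
  proof -
    obtain i where k: "k = i + 2" using \<open>k \<in> {2..}\<close> by (metis atLeast_iff le_add_diff_inverse2)
    have "(D ^^ k) ?h = ((- 1) ^ i * fact i) *c
        (shift (of_nat (n + 1)) (x_powi (- int (i + 1))) - x_powi (- int (i + 1)))"
      unfolding D_pow_shift_minus_id k D_pow_log_prim shift_cscale
      by (rule ila_eqI) (simp add: right_diff_distrib)
    moreover have "bernoulli k / fact k = inverse J_fps $ k"
      by (simp add: bernoulli_altdef)
    ultimately show ?thesis
      by (simp only:) (rule ila_eqI, simp add: k)
  qed
  ultimately have tail: "has_fsum ?g {2..} (L - (\<Sum>k<2. ?f k))"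
    by (simp only: has_fsum_cong[of "{2..}" ?f ?g])
  \<comment> \<open>The indices 0 and 1 are split off because there the derivative of
    \<open>log_prim\<close> still contains a logarithm.\<close>
  have "?f 0 = bernoulli 0 *c (shift (of_nat (n + 1)) x_log_x - x_log_x - const (of_nat (n + 1)))"
    by (simp add: bernoulli_altdef shift_log_prim_minus_id)
  moreover have "?f 1 = bernoulli 1 *c (shift (of_nat (n + 1)) log_x - log_x)"
    using D_pow_shift_minus_id[of 1 "of_nat (n + 1)" log_prim]
    by (simp add: bernoulli_altdef D_log_prim)
  moreover have "(\<Sum>k<2. ?f k) = ?f 0 + ?f 1"
    by (simp add: numeral_2_eq_2)
  ultimately have head: "(\<Sum>k<2. ?f k) =
      bernoulli 0 *c (shift (of_nat (n + 1)) x_log_x - x_log_x - const (of_nat (n + 1))) +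
      bernoulli 1 *c (shift (of_nat (n + 1)) log_x - log_x)"
    by (simp only:)
  \<comment> \<open>By \<open>tail\<close> the series over \<open>k \<ge> 2\<close> is summable with
    value \<open>L\<close> minus the head, so adding the head back gives \<open>L\<close>.\<close>
  show ?thesis
    using tail unfolding head L_def[symmetric] fsum_eqI[OF tail[unfolded head]]
    by (auto simp: fsummable_def)
qed

end
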